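(* Let $n\geq 2$. For any matrix $W$ in the spectral unit ball $\Omega_n$, let \[ z^n-s_1z^{n-1}+\dots+(-1)^{n-1}s_{n-1}z+(-1)^ns_n=0 \] denote the characteristic equation of $W$, and define the rational function \[ F_{s(W)}(z):=\frac{(-1)^n n s_n z^{n-1}+(-1)^{n-1}(n-1)s_{n-1}z^{n-2}+\dots+(-s_1)}{n-(n-1)s_1 z+\dots+(-1)^{n-1}s_{n-1}z^{n-1}},\quad z\in\mathbb{C}. \] 1) Let $W\in\Omega_n$. Then \[ \widetilde{\kappa}_{n\times n}(0,W)=\tanh^{-1}\left[\inf\left\{t>0:\frac{1}{t}\sup_{|z|=1/t}|F_{s(W)}(z)|<1\right\}\right]=\tanh^{-1}(r(W)). \] 2) Let $\zeta_1,\zeta_2\in D$ be distinct and let $W\in\Omega_n$. There exists a map $f\in\mathcal{O}(D;\Omega_n)$ such that $f(\zeta_1)=0$ and $f(\zeta_2)=W$ if and only if \[ r(W)=\inf\left\{t>0:\frac{1}{t}\sup_{|z|=1/t}|F_{s(W)}(z)|<1\right\}\ \leq\ \left|\frac{\zeta_2-\zeta_1}{1-\overline{\zeta_1}\zeta_2}\right|. \]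
   Context: $D$ denotes the open unit disc in $\mathbb{C}$, $M_n(\mathbb{C})$ the space of $n\times n$ complex matrices, $r(W)$ the spectral radius of $W$, and $\Omega_n:=\{W\in M_n(\mathbb{C}):r(W)<1\}$ the spectral unit ball, a domain in $M_n(\mathbb{C})\cong\mathbb{C}^{n^2}$. $\mathcal{O}(X;Y)$ denotes the class of holomorphic maps from $X$ into $Y$. $\widetilde{\kappa}_{n\times n}$ denotes the Lempert function of $\Omega_n$: for $W_1,W_2\in\Omega_n$, \[ \widetilde{\kappa}_{n\times n}(W_1,W_2):=\inf\{p_D(0,\zeta):\zeta\in D\text{ and }\exists\,\varphi\in\mathcal{O}(D;\Omega_n)\text{ such that }\varphi(0)=W_1,\ \varphi(\zeta)=W_2\}, \] where $p_D$ is the Poincaré distance on $D$, normalized so that $p_D(\zeta_1,\zeta_2)=\tanh^{-1}\left|\frac{\zeta_2-\zeta_1}{1-\overline{\zeta_1}\zeta_2}\right|$. In $F_{s(W)}$, the numerator is $\sum_{j=1}^n(-1)^j j s_j z^{j-1}$ and the denominator is $n+\sum_{j=1}^{n-1}(-1)^j(n-j)s_jz^j$.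
   Formalization: The infimum is taken only over t > 0 for which F_{s(W)} has no pole in |z| ≤ 1/t; without this the formula fails, e.g. for n = 3, W = diag(1/2,0,0), where all 0 < t < 1/6 also qualify and the infimum is 0 while r(W) = 1/2. Removable singularities of F are removed. *)

theory Defs
  imports "HOL-Complex_Analysis.Complex_Analysis" "Jordan_Normal_Form.Spectral_Radius"
begin

definition spectral_unit_ball :: "nat \<Rightarrow> complex mat set" where
  "spectral_unit_ball n = {W \<in> carrier_mat n n. spectral_radius W < 1}"

text \<open>Under the identification of \<open>M\<^sub>n(\<complex>)\<close> with \<open>\<complex>\<^bsup>n\<^sup>2\<^esup>\<close>, a map from a planar domain
  into \<open>M\<^sub>n(\<complex>)\<close> is holomorphic iff each of its entries is.\<close>

definition disc_maps :: "nat \<Rightarrow> (complex \<Rightarrow> complex mat) set" where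
  "disc_maps n = {\<phi>. (\<forall>z\<in>ball 0 1. \<phi> z \<in> spectral_unit_ball n) \<and>
     (\<forall>i<n. \<forall>j<n. (\<lambda>z. \<phi> z $$ (i, j)) holomorphic_on ball 0 1)}"

definition poincare_dist :: "complex \<Rightarrow> complex \<Rightarrow> real" where
  "poincare_dist \<zeta>\<^sub>1 \<zeta>\<^sub>2 = artanh (cmod ((\<zeta>\<^sub>2 - \<zeta>\<^sub>1) / (1 - cnj \<zeta>\<^sub>1 * \<zeta>\<^sub>2)))"

text \<open>The infimum is a real infimum: the set is bounded below by 0, and it is nonempty for all
  \<open>W\<^sub>1, W\<^sub>2\<close> in the spectral unit ball, as this is a domain.\<close>

definition lempert :: "nat \<Rightarrow> complex mat \<Rightarrow> complex mat \<Rightarrow> real" where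
  "lempert n W\<^sub>1 W\<^sub>2 = Inf {poincare_dist 0 \<zeta> | \<zeta>. \<zeta> \<in> ball 0 1 \<and>
     (\<exists>\<phi>\<in>disc_maps n. \<phi> 0 = W\<^sub>1 \<and> \<phi> \<zeta> = W\<^sub>2)}"

text \<open>The signed coefficients \<open>s\<^sub>j\<close> in
  \<open>char_poly W = z\<^sup>n - s\<^sub>1 z\<^bsup>n-1\<^esup> + \<dots> + (-1)\<^sup>n s\<^sub>n\<close>, for \<open>j \<le> n\<close> (with \<open>s\<^sub>0 = 1\<close>).\<close>

definition char_coeff :: "complex mat \<Rightarrow> nat \<Rightarrow> complex" where
  "char_coeff W j = (-1) ^ j * coeff (char_poly W) (dim_row W - j)"

lemma char_coeff_0:
  assumes "W \<in> carrier_mat n n"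
  shows "char_coeff W 0 = 1"
  using degree_monic_char_poly[OF assms] assms by (simp add: char_coeff_def)

lemma poly_char_poly_char_coeff:
  assumes W: "W \<in> carrier_mat n n"
  shows "poly (char_poly W) z = (\<Sum>j\<le>n. (-1) ^ j * char_coeff W j * z ^ (n - j))"
proof -
  have "poly (char_poly W) z = (\<Sum>i\<le>n. coeff (char_poly W) i * z ^ i)"
    using degree_monic_char_poly[OF W] by (simp add: poly_altdef)
  also have "\<dots> = (\<Sum>j\<le>n. coeff (char_poly W) (n - j) * z ^ (n - j))"
    by (rule sum.reindex_bij_witness[of _ "\<lambda>j. n - j" "\<lambda>j. n - j"]) auto
  also have "\<dots> = (\<Sum>j\<le>n. (-1) ^ j * char_coeff W j * z ^ (n - j))"
    using W by (intro sum.cong)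
      (auto simp: char_coeff_def mult.assoc[symmetric] simp flip: power_add mult_2)
  finally show ?thesis .
qed

text \<open>The rational function \<open>F\<^bsub>s(W)\<^esub>\<close>. Numerator and denominator have a common zero at the
  reciprocal of every multiple nonzero eigenvalue, so \<^const>\<open>remove_sings\<close> is needed to give the
  quotient its value as a rational function there. The value 0 that it has at the poles is never
  used below.\<close>

definition rat_F :: "complex mat \<Rightarrow> complex \<Rightarrow> complex" where
  "rat_F W = (let n = dim_row W; s = char_coeff W in
     remove_sings (\<lambda>z.
       (\<Sum>j=1..n. (-1) ^ j * of_nat j * s j * z ^ (j - 1)) /
       (of_nat n + (\<Sum>j=1..n-1. (-1) ^ j * of_nat (n - j) * s j * z ^ j))))"

text \<open>The number \<open>inf {t > 0 : (1/t) sup\<^bsub>|z|=1/t\<^esub> |F\<^bsub>s(W)\<^esub>(z)| < 1}\<close>, where the supremum over the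
  circle stands for the supremum over the closed disc that it bounds; that is,
  \<open>F\<^bsub>s(W)\<^esub>\<close> is required to have no pole in \<open>|z| \<le> 1/t\<close>.
  This requirement cannot be dropped when \<open>n \<ge> 3\<close>. For \<open>W = diag(1/2, 0, 0)\<close> one has
  \<open>F\<^bsub>s(W)\<^esub>(z) = -1 / (6 - 2 z)\<close>, and \<open>(1/t) sup\<^bsub>|z|=1/t\<^esub> |F\<^bsub>s(W)\<^esub>(z)| < 1\<close> holds not only for
  \<open>t > 1/2\<close> but also for all \<open>0 < t < 1/6\<close>, where the circle encloses the pole \<open>z = 3\<close>; the infimum
  over all these \<open>t\<close> is 0, while the spectral radius is \<open>1/2\<close>.\<close>

definition F_radius :: "complex mat \<Rightarrow> real" where
  "F_radius W = Inf {t. 0 < t \<and> (\<forall>z\<in>cball 0 (1 / t). \<not> is_pole (rat_F W) z) \<and>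
     1 / t * (SUP z\<in>sphere 0 (1 / t). cmod (rat_F W z)) < 1}"

end

theory Submission
  imports Defs
begin

text \<open>If \<open>\<phi>\<close> maps the disc into the spectral unit ball and \<open>\<phi> 0 = 0\<close>, then \<open>tr (\<phi> z ^ k)\<close> is
  holomorphic, bounded by \<open>n\<close>, and divisible by \<open>z ^ k\<close>; hence \<open>\<bar>tr (\<phi> z ^ k)\<bar> \<le> n \<bar>z\<bar> ^ k\<close> for all \<open>k\<close>,
  and these bounds on the power sums of the eigenvalues give \<open>r(\<phi> z) \<le> \<bar>z\<bar>\<close>. Conversely, if
  \<open>r(W) \<le> \<bar>m\<bar>\<close>, then \<open>z \<mapsto> (z / m) W\<close> is an extremal map.

  With \<open>q z = \<Prod>i. (1 - \<lambda>\<^sub>i z)\<close>, the function \<open>F\<^bsub>s(W)\<^esub>\<close> is \<open>q' / (n q - z q')\<close>, so that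
  \<open>1 + z F z = n / (\<Sum>i. 1 / (1 - \<lambda>\<^sub>i z))\<close>. Since \<open>Re (1 / (1 - w)) > 1/2\<close> for \<open>\<bar>w\<bar> < 1\<close>, this gives
  \<open>\<bar>z F z\<bar> < 1\<close> whenever \<open>\<bar>z\<bar> r(W) < 1\<close>. At \<open>z = 1 / \<lambda>\<^sub>i\<close> the right-hand side vanishes and
  \<open>z F z = -1\<close>; by the maximum principle no \<open>t \<le> r(W)\<close> is admissible.\<close>

section \<open>Traces, triangular form and eigenvalues\<close>

definition mat_trace :: "'a :: comm_semiring_1 mat \<Rightarrow> 'a" where
  "mat_trace A = (\<Sum>i<dim_row A. A $$ (i, i))"

lemma index_mult_mat_sum:
  assumes "A \<in> carrier_mat n n" "B \<in> carrier_mat n n" "i < n" "j < n"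
  shows "(A * B) $$ (i, j) = (\<Sum>k<n. A $$ (i, k) * B $$ (k, j))"
  using assms by (auto simp: scalar_prod_def lessThan_atLeast0)

lemma mat_trace_mult_commute:
  assumes "A \<in> carrier_mat n n" "B \<in> carrier_mat n n"
  shows "mat_trace (A * B) = mat_trace (B * A)"
proof -
  have "mat_trace (A * B) = (\<Sum>i<n. \<Sum>k<n. A $$ (i, k) * B $$ (k, i))"
    using assms by (simp add: mat_trace_def index_mult_mat_sum del: index_mult_mat(1))
  also have "\<dots> = (\<Sum>k<n. \<Sum>i<n. B $$ (k, i) * A $$ (i, k))"
    by (subst sum.swap) (simp add: mult.commute)
  also have "\<dots> = mat_trace (B * A)"
    using assms by (simp add: mat_trace_def index_mult_mat_sum del: index_mult_mat(1))
  finally show ?thesis .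
qed

lemma mat_trace_similar:
  assumes "similar_mat_wit A B P Q"
  shows "mat_trace A = mat_trace B"
proof -
  obtain n where "n = dim_row A" by blast
  note w = similar_mat_witD[OF this assms]
  have "mat_trace A = mat_trace (P * (B * Q))"
    unfolding w(3) using w(5-7) by (simp only: assoc_mult_mat)
  also have "\<dots> = mat_trace (B * Q * P)"
    using w(5-7) by (intro mat_trace_mult_commute mult_carrier_mat)
  also have "B * Q * P = B"
    using assoc_mult_mat[OF w(5,7,6)] w(2,5) by simp
  finally show ?thesis .
qed

lemma upper_triangular_pow:
  fixes B :: "'a :: comm_semiring_1 mat"
  assumes B: "B \<in> carrier_mat n n" "upper_triangular B"
  shows "j \<le> i \<Longrightarrow> i < n \<Longrightarrow> (B ^\<^sub>m k) $$ (i, j) = (if i = j then B $$ (i, i) ^ k else 0)"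
proof (induction k arbitrary: i j)
  case 0
  then show ?case using B by auto
next
  case (Suc k)
  have "(B ^\<^sub>m Suc k) $$ (i, j) = (\<Sum>l<n. (B ^\<^sub>m k) $$ (i, l) * B $$ (l, j))"
    using B Suc.prems by (simp add: index_mult_mat_sum[where n = n] del: index_mult_mat(1))
  \<comment> \<open>Only \<open>l = i\<close> survives: for \<open>l < i\<close> the power vanishes
    by induction, and for \<open>l > i\<close> the entry of \<open>B\<close> vanishes because
    \<open>j \<le> i < l\<close>.\<close>
  also have "\<dots> = (\<Sum>l<n. if l = i then B $$ (i, i) ^ k * B $$ (i, j) else 0)"
  proof (rule sum.cong)
    fix l assume "l \<in> {..<n}"
    then show "(B ^\<^sub>m k) $$ (i, l) * B $$ (l, j) = (if l = i then B $$ (i, i) ^ k * B $$ (i, j) else 0)"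
      using Suc.IH[of l i] Suc.prems upper_triangularD[OF B(2), of j l] B(1)
      by (cases "l \<le> i") auto
  qed auto
  also have "\<dots> = (if i = j then B $$ (i, i) ^ Suc k else 0)"
    using Suc.prems upper_triangularD[OF B(2), of j i] B(1) by (auto simp: mult.commute)
  finally show ?case .
qed

text \<open>The \<open>a i\<close> are the diagonal entries of a Schur triangular form, hence the
  eigenvalues with multiplicity. Powers of that form carry the powers of the \<open>a i\<close> on
  the diagonal, and similarity preserves traces.\<close>

lemma eigenvalue_enumeration:
  fixes A :: "complex mat"
  assumes A: "A \<in> carrier_mat n n"
  obtains a where "char_poly A = (\<Prod>i<n. [:- a i, 1:])"
    and "\<And>k. mat_trace (A ^\<^sub>m k) = (\<Sum>i<n. a i ^ k)"
proof -
  obtain as where as: "char_poly A = (\<Prod>a\<leftarrow>as. [:- a, 1:])"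
    using char_poly_factorized[OF A] by blast
  obtain B P Q where BPQ: "schur_decomposition A as = (B, P, Q)"
    by (cases "schur_decomposition A as") auto
  from schur_decomposition[OF A as BPQ]
  have sim: "similar_mat_wit A B P Q" and ut: "upper_triangular B" and diag: "diag_mat B = as"
    by auto
  from similar_mat_witD2[OF A sim] have B: "B \<in> carrier_mat n n" by auto
  show thesis
  proof
    show "char_poly A = (\<Prod>i<n. [:- B $$ (i, i), 1:])"
      using B unfolding as diag[symmetric] diag_mat_def
      by (simp add: comp_def prod.list_conv_set_nth lessThan_atLeast0)
    show "mat_trace (A ^\<^sub>m k) = (\<Sum>i<n. B $$ (i, i) ^ k)" for k
      using mat_trace_similar[OF similar_mat_wit_pow[OF sim, of k]] B
        upper_triangular_pow[OF B ut] by (simp add: mat_trace_def)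
  qed
qed

lemma spectrum_prod:
  fixes A :: "complex mat"
  assumes "A \<in> carrier_mat n n" "char_poly A = (\<Prod>i<n. [:- a i, 1:])"
  shows "spectrum A = a ` {..<n}"
  unfolding spectrum_root_char_poly[OF assms(1)] assms(2) by (auto simp: poly_prod)

text \<open>An eigenvector of the scaled matrix for \<open>\<mu>\<close> is one of \<open>A\<close>
  for \<open>\<mu> / c\<close>; if \<open>c = 0\<close>, then \<open>\<mu> = 0\<close>. This keeps
  the extremal map inside the spectral unit ball.\<close>

lemma spectral_radius_smult_le:
  assumes A: "A \<in> carrier_mat n n" and n: "n > 0"
  shows "spectral_radius (c \<cdot>\<^sub>m A) \<le> cmod c * spectral_radius A"
proof -
  have cA: "c \<cdot>\<^sub>m A \<in> carrier_mat n n" using A by auto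
  from spectral_radius_mem_max(1)[OF cA n]
  obtain \<mu> where \<mu>: "\<mu> \<in> spectrum (c \<cdot>\<^sub>m A)" "spectral_radius (c \<cdot>\<^sub>m A) = cmod \<mu>" by auto
  then obtain v where v: "v \<in> carrier_vec n" "v \<noteq> 0\<^sub>v n" "(c \<cdot>\<^sub>m A) *\<^sub>v v = \<mu> \<cdot>\<^sub>v v"
    using A by (auto simp: spectrum_def eigenvalue_def eigenvector_def)
  have "(c \<cdot>\<^sub>m A) *\<^sub>v v = c \<cdot>\<^sub>v (A *\<^sub>v v)"
    using v(1) A by (intro eq_vecI) auto
  with v have cv: "c \<cdot>\<^sub>v (A *\<^sub>v v) = \<mu> \<cdot>\<^sub>v v" by simp
  show ?thesis
  proof (cases "c = 0")
    case True
    obtain i where i: "i < n" "v $ i \<noteq> 0"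
      using v(1,2) by (metis carrier_vecD eq_vecI index_zero_vec)
    have "(c \<cdot>\<^sub>v (A *\<^sub>v v)) $ i = (\<mu> \<cdot>\<^sub>v v) $ i" by (simp only: cv)
    then have "\<mu> = 0" using True i v(1) A by simp
    then show ?thesis using \<mu> True by simp
  next
    case False
    then have "A *\<^sub>v v = (\<mu> / c) \<cdot>\<^sub>v v"
      using arg_cong[OF cv, of "\<lambda>w. inverse c \<cdot>\<^sub>v w"]
      by (simp add: smult_smult_assoc divide_inverse mult.commute)
    then have "\<mu> / c \<in> spectrum A"
      using v A by (auto simp: spectrum_def eigenvalue_def eigenvector_def)
    then have "cmod (\<mu> / c) \<le> spectral_radius A"
      using spectral_radius_mem_max(2)[OF A n] by blast
    then show ?thesis using \<mu> False by (simp add: norm_divide pos_divide_le_eq mult.commute)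
  qed
qed

lemma spectral_radius_nonneg:
  assumes "A \<in> carrier_mat n n" "n > 0"
  shows "0 \<le> spectral_radius A"
  using spectral_radius_mem_max(1)[OF assms] by auto

section \<open>Power sums control the largest modulus\<close>

text \<open>The map \<open>w \<mapsto> 1 / (1 - w)\<close> sends the unit disc to the half-plane to
  the right of \<open>1 / 2\<close>. It serves both the power sums and the estimate of
  \<open>rat_F\<close>.\<close>

lemma Re_inverse_one_minus:
  assumes "cmod w < 1"
  shows "1 / 2 < Re (1 / (1 - w))"
proof -
  have w: "Re w < 1" using assms complex_Re_le_cmod[of w] by linarith
  have "(Re w)\<^sup>2 + (Im w)\<^sup>2 < 1"
    using assms by (simp add: cmod_def)
  moreover have "0 < (1 - Re w)\<^sup>2 + (Im w)\<^sup>2" using w by (simp add: add_pos_nonneg)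
  moreover have "Re (1 / (1 - w)) = (1 - Re w) / ((1 - Re w)\<^sup>2 + (Im w)\<^sup>2)"
    by (simp add: Re_divide)
  ultimately show ?thesis
    by (simp add: pos_less_divide_eq power2_eq_square algebra_simps)
qed

text \<open>Otherwise the \<open>\<mu>\<close> of maximal modulus among the \<open>a i\<close> has \<open>R < \<bar>\<mu>\<bar>\<close>. The power series with
  coefficients \<open>\<Sum>i. (a i / \<mu>) ^ k\<close> is then bounded on \<open>[0, 1)\<close>, whereas its sum
  \<open>\<Sum>i. 1 / (1 - x * a i / \<mu>)\<close> has real part at least \<open>1 / (1 - x)\<close>.\<close>

lemma power_sum_bound:
  fixes a :: "nat \<Rightarrow> complex"
  assumes bd: "\<And>k. cmod (\<Sum>i<n. a i ^ k) \<le> C * R ^ k" and R: "0 \<le> R" and j: "j < n"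
  shows "cmod (a j) \<le> R"
proof (rule ccontr)
  assume not_le: "\<not> cmod (a j) \<le> R"
  define M where "M = Max ((\<lambda>i. cmod (a i)) ` {..<n})"
  have "M \<in> (\<lambda>i. cmod (a i)) ` {..<n}"
    unfolding M_def using j by (intro Max_in) auto
  then obtain m where m: "m < n" "M = cmod (a m)" by auto
  have M: "cmod (a i) \<le> M" if "i < n" for i
    unfolding M_def using that by (intro Max_ge) auto
  have RM: "R < M" using M[OF j] not_le by simp
  with R have M0: "0 < M" by simp
  then have am: "a m \<noteq> 0" using m by auto
  \<comment> \<open>The sum of the majorant \<open>C * (R / M) ^ k\<close>, a bound independent of
    \<open>x\<close>.\<close>
  define K where "K = C * (1 / (1 - R / M))"
  have "1 / (1 - x) \<le> K" if x: "0 \<le> x" "x < 1" for x :: real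
  proof -
    \<comment> \<open>The factor \<open>x < 1\<close> pulls every quotient \<open>a i / a m\<close>
      strictly inside the disc, so the geometric series converge.\<close>
    define b where "b i = of_real x * a i / a m" for i
    have b: "cmod (b i) < 1" if "i < n" for i
    proof -
      have "cmod (b i) = x * (cmod (a i) / M)" using x m by (simp add: b_def norm_mult norm_divide)
      also have "\<dots> \<le> x * 1" using M[OF that] M0 x by (intro mult_left_mono) auto
      finally show ?thesis using x by simp
    qed
    have bs: "(\<lambda>k. \<Sum>i<n. b i ^ k) sums (\<Sum>i<n. 1 / (1 - b i))"
      by (intro sums_sum geometric_sums) (auto simp: b)
    have nb: "cmod (\<Sum>i<n. b i ^ k) \<le> C * (R / M) ^ k" for k
    proof -
      have "(\<Sum>i<n. b i ^ k) = (of_real x / a m) ^ k * (\<Sum>i<n. a i ^ k)"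
        by (simp add: b_def sum_distrib_left power_mult_distrib power_divide)
      then have "cmod (\<Sum>i<n. b i ^ k) = x ^ k * cmod (\<Sum>i<n. a i ^ k) / M ^ k"
        using x m by (simp add: norm_mult norm_power norm_divide power_divide)
      also have "\<dots> \<le> 1 * (C * R ^ k) / M ^ k"
        using bd[of k] x M0 by (intro divide_right_mono mult_mono power_le_one) auto
      finally show ?thesis by (simp add: power_divide)
    qed
    have Ks: "(\<lambda>k. C * (R / M) ^ k) sums K"
      unfolding K_def using R RM by (intro sums_mult geometric_sums) auto
    \<comment> \<open>Here \<open>b m = x\<close>, and all other summands have positive real
      part.\<close>
    have "1 / (1 - x) = Re (1 / (1 - b m))"
      using am by (simp add: b_def complex_of_real_def Re_divide power2_eq_square)
    also have "\<dots> \<le> (\<Sum>i<n. Re (1 / (1 - b i)))"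
      using m(1) Re_inverse_one_minus[OF b] by (intro member_le_sum) force+
    also have "\<dots> \<le> cmod (\<Sum>i<n. 1 / (1 - b i))"
      by (metis Re_sum complex_Re_le_cmod)
    also have "\<dots> \<le> K"
      using norm_sums_le[OF bs Ks nb] .
    finally show ?thesis .
  qed
  \<comment> \<open>The value at \<open>0\<close> gives \<open>1 \<le> K\<close>, so the second
    point lies in \<open>[0, 1)\<close>; there the bound reads \<open>K + 1 \<le> K\<close>.\<close>
  from this[of 0] this[of "1 - 1 / (K + 1)"] show False
    by (auto simp: field_simps)
qed

section \<open>The Schwarz lemma for the spectral radius\<close>

text \<open>On the circle of radius \<open>\<rho>\<close> the hypothesis gives the bound
  \<open>B / \<rho> ^ k\<close>. The maximum principle carries it inside, and \<open>\<rho>\<close>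
  then tends to 1.\<close>

lemma bound_cancel_power:
  assumes G: "G holomorphic_on ball 0 1"
    and bd: "\<And>z. z \<in> ball 0 1 \<Longrightarrow> cmod (z ^ k * G z) \<le> B"
    and z: "z \<in> ball 0 1"
  shows "cmod (G z) \<le> B"
proof -
  have *: "\<rho> ^ k * cmod (G z) \<le> B" if \<rho>: "cmod z < \<rho>" "\<rho> < 1" for \<rho>
  proof -
    have "0 < \<rho>" using \<rho> by (smt (verit) norm_ge_zero)
    have sub: "cball 0 \<rho> \<subseteq> ball (0::complex) 1" using \<rho> by auto
    have "cmod (G z) \<le> B / \<rho> ^ k"
    proof (rule maximum_modulus_frontier[of G "cball 0 \<rho>"])
      show "G holomorphic_on interior (cball 0 \<rho>)"
        using G by (rule holomorphic_on_subset) (use sub interior_subset in blast)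
      show "continuous_on (closure (cball 0 \<rho>)) G"
        using holomorphic_on_subset[OF G sub] by (simp add: holomorphic_on_imp_continuous_on)
      fix w :: complex assume "w \<in> frontier (cball 0 \<rho>)"
      then have "cmod w = \<rho>" using \<open>0 < \<rho>\<close> by simp
      with bd[of w] \<rho> \<open>0 < \<rho>\<close> show "cmod (G w) \<le> B / \<rho> ^ k"
        by (simp add: norm_mult norm_power field_simps)
    qed (use \<rho> in auto)
    then show ?thesis using \<open>0 < \<rho>\<close> by (simp add: field_simps)
  qed
  have "((\<lambda>\<rho>. \<rho> ^ k * cmod (G z)) \<longlongrightarrow> 1 ^ k * cmod (G z)) (at_left 1)"
    by (intro tendsto_intros)
  moreover have "eventually (\<lambda>\<rho>. \<rho> ^ k * cmod (G z) \<le> B) (at_left 1)"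
    using eventually_at_left_real[of "cmod z" 1] z
    by (auto elim!: eventually_mono intro: *)
  ultimately show ?thesis
    using tendsto_upperbound[of _ _ "at_left (1::real)"] by fastforce
qed

text \<open>Every entry of \<open>\<phi>\<close> vanishes at 0 and so splits off a factor
  \<open>z\<close> with holomorphic quotient; each matrix multiplication adds one such
  factor.\<close>

lemma holomorphic_entries_pow:
  assumes c: "\<And>z. z \<in> ball 0 1 \<Longrightarrow> \<phi> z \<in> carrier_mat n n"
    and hol: "\<And>i j. i < n \<Longrightarrow> j < n \<Longrightarrow> (\<lambda>z. \<phi> z $$ (i, j)) holomorphic_on ball 0 1"
    and 0: "\<phi> 0 = 0\<^sub>m n n"
  shows "\<exists>g. \<forall>i<n. \<forall>j<n. g i j holomorphic_on ball 0 1 \<and>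
           (\<forall>z\<in>ball 0 1. (\<phi> z ^\<^sub>m k) $$ (i, j) = z ^ k * g i j z)"
proof (induction k)
  case 0
  have "(\<phi> z ^\<^sub>m 0) $$ (i, j) = z ^ 0 * (if i = j then 1 else 0)"
    if "z \<in> ball 0 1" "i < n" "j < n" for z i j
    using c[OF that(1)] that by auto
  then show ?case
    by (intro exI[of _ "\<lambda>i j z. if i = j then 1 else 0"] allI impI conjI ballI) auto
next
  case (Suc k)
  then obtain g where g: "\<And>i j. i < n \<Longrightarrow> j < n \<Longrightarrow> g i j holomorphic_on ball 0 1"
    "\<And>i j z. i < n \<Longrightarrow> j < n \<Longrightarrow> z \<in> ball 0 1 \<Longrightarrow> (\<phi> z ^\<^sub>m k) $$ (i, j) = z ^ k * g i j z"
    by blast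
  have "\<exists>h. h holomorphic_on ball 0 1 \<and> (\<forall>z\<in>ball 0 1. \<phi> z $$ (i, j) = z * h z)"
    if "i < n" "j < n" for i j
  proof (rule Schwarz3[OF hol[OF that]])
    show "\<phi> 0 $$ (i, j) = 0" using 0 that by simp
  qed auto
  then obtain h where h: "\<And>i j. i < n \<Longrightarrow> j < n \<Longrightarrow> h i j holomorphic_on ball 0 1"
    "\<And>i j z. i < n \<Longrightarrow> j < n \<Longrightarrow> z \<in> ball 0 1 \<Longrightarrow> \<phi> z $$ (i, j) = z * h i j z"
    by metis
  show ?case
  proof (intro exI[of _ "\<lambda>i j z. \<Sum>l<n. g i l z * h l j z"] allI impI conjI ballI)
    fix i j assume ij: "i < n" "j < n"
    show "(\<lambda>z. \<Sum>l<n. g i l z * h l j z) holomorphic_on ball 0 1"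
      using g(1) h(1) ij by (intro holomorphic_intros) auto
    fix z :: complex assume z: "z \<in> ball 0 1"
    have "(\<phi> z ^\<^sub>m Suc k) $$ (i, j) = (\<Sum>l<n. (\<phi> z ^\<^sub>m k) $$ (i, l) * \<phi> z $$ (l, j))"
      unfolding pow_mat.simps using c[OF z] ij by (intro index_mult_mat_sum) auto
    also have "\<dots> = (\<Sum>l<n. z ^ Suc k * (g i l z * h l j z))"
      using g(2) h(2) ij z by (intro sum.cong) auto
    finally show "(\<phi> z ^\<^sub>m Suc k) $$ (i, j) = z ^ Suc k * (\<Sum>l<n. g i l z * h l j z)"
      by (simp only: sum_distrib_left)
  qed
qed

text \<open>Usually derived from Vesentini's theorem that the spectral radius is subharmonic; the trace
  functions \<open>tr (\<phi> z ^ k) / z ^ k\<close> replace it here.\<close>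

theorem spectral_radius_Schwarz:
  assumes n: "n > 0" and \<phi>: "\<phi> \<in> disc_maps n" "\<phi> 0 = 0\<^sub>m n n" and z: "z \<in> ball 0 1"
  shows "spectral_radius (\<phi> z) \<le> cmod z"
proof -
  have c: "\<phi> z \<in> carrier_mat n n" and r: "spectral_radius (\<phi> z) < 1" if "z \<in> ball 0 1" for z
    using \<phi>(1) that by (auto simp: disc_maps_def spectral_unit_ball_def)
  have trace_le: "cmod (mat_trace (\<phi> w ^\<^sub>m k)) \<le> n" if w: "w \<in> ball 0 1" for w k
  proof -
    obtain a where a: "char_poly (\<phi> w) = (\<Prod>i<n. [:- a i, 1:])"
      "\<And>k. mat_trace (\<phi> w ^\<^sub>m k) = (\<Sum>i<n. a i ^ k)"
      by (rule eigenvalue_enumeration[OF c[OF w]]) blast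
    have "cmod (a i) \<le> 1" if "i < n" for i
      using spectral_radius_mem_max(2)[OF c[OF w] n, of "cmod (a i)"] r[OF w] that
        spectrum_prod[OF c[OF w] a(1)] by force
    then have "cmod (\<Sum>i<n. a i ^ k) \<le> (\<Sum>i<n. 1)"
      by (intro sum_norm_le) (auto simp: norm_power power_le_one)
    then show ?thesis by (simp add: a(2))
  qed
  have trace_le_power: "cmod (mat_trace (\<phi> z ^\<^sub>m k)) \<le> n * cmod z ^ k" for k
  proof -
    have "\<exists>g. \<forall>i<n. \<forall>j<n. g i j holomorphic_on ball 0 1 \<and>
           (\<forall>z\<in>ball 0 1. (\<phi> z ^\<^sub>m k) $$ (i, j) = z ^ k * g i j z)"
      using \<phi> c by (intro holomorphic_entries_pow) (auto simp: disc_maps_def)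
    then obtain g where g: "\<And>i. i < n \<Longrightarrow> g i i holomorphic_on ball 0 1"
      "\<And>i z. i < n \<Longrightarrow> z \<in> ball 0 1 \<Longrightarrow> (\<phi> z ^\<^sub>m k) $$ (i, i) = z ^ k * g i i z"
      by blast
    define G where "G z = (\<Sum>i<n. g i i z)" for z
    have eq: "mat_trace (\<phi> w ^\<^sub>m k) = w ^ k * G w" if "w \<in> ball 0 1" for w
      using g(2) that c[OF that] by (simp add: mat_trace_def G_def sum_distrib_left)
    have "cmod (G z) \<le> n"
    proof (rule bound_cancel_power[OF _ _ z])
      show "G holomorphic_on ball 0 1"
        unfolding G_def using g(1) by (intro holomorphic_intros) auto
      show "cmod (w ^ k * G w) \<le> n" if "w \<in> ball 0 1" for w
        using trace_le[OF that, of k] eq[OF that] by simp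
    qed
    then have "cmod z ^ k * cmod (G z) \<le> cmod z ^ k * n"
      by (intro mult_left_mono) auto
    then show ?thesis using eq[OF z] by (simp add: norm_mult norm_power mult.commute)
  qed
  obtain a where a: "char_poly (\<phi> z) = (\<Prod>i<n. [:- a i, 1:])"
    "\<And>k. mat_trace (\<phi> z ^\<^sub>m k) = (\<Sum>i<n. a i ^ k)"
    by (rule eigenvalue_enumeration[OF c[OF z]]) blast
  have "cmod (a i) \<le> cmod z" if "i < n" for i
    using power_sum_bound[where a = a and n = n and C = n and R = "cmod z"] trace_le_power that
    by (simp add: a(2))
  then show ?thesis
    using spectral_radius_mem_max(1)[OF c[OF z] n] spectrum_prod[OF c[OF z] a(1)] by force
qed

section \<open>Two-point interpolation\<close>

text \<open>A disc automorphism moves \<open>\<zeta>1\<close> to 0 and \<open>\<zeta>2\<close> to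
  \<open>m\<close>. Necessity is then the Schwarz lemma at \<open>m\<close>, and sufficiency comes
  from the linear map through \<open>W\<close>.\<close>

lemma disc_maps_Schwarz_Pick:
  assumes n: "n > 0" and W: "W \<in> spectral_unit_ball n"
    and \<zeta>: "\<zeta>1 \<in> ball 0 1" "\<zeta>2 \<in> ball 0 1" "\<zeta>1 \<noteq> \<zeta>2"
  shows "(\<exists>f\<in>disc_maps n. f \<zeta>1 = 0\<^sub>m n n \<and> f \<zeta>2 = W) \<longleftrightarrow>
    spectral_radius W \<le> cmod ((\<zeta>2 - \<zeta>1) / (1 - cnj \<zeta>1 * \<zeta>2))"
proof -
  define m where "m = Moebius_function 0 \<zeta>1 \<zeta>2"
  have m: "m = (\<zeta>2 - \<zeta>1) / (1 - cnj \<zeta>1 * \<zeta>2)"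
    by (simp add: m_def Moebius_function_simple)
  have m1: "cmod m < 1"
    unfolding m_def using \<zeta> by (intro Moebius_function_norm_lt_1) auto
  have inv: "Moebius_function 0 (- \<zeta>1) m = \<zeta>2"
    unfolding m_def using \<zeta> by (intro Moebius_function_compose) auto
  \<comment> \<open>The inverse automorphism sends 0 to \<open>\<zeta>1\<close> and \<open>m\<close>
    to \<open>\<zeta>2\<close>, which differ.\<close>
  with \<zeta>(3) have m0: "m \<noteq> 0"
    by (auto simp: Moebius_function_of_zero)
  have Wc: "W \<in> carrier_mat n n" and W1: "spectral_radius W < 1"
    using W by (auto simp: spectral_unit_ball_def)
  show ?thesis
    unfolding m[symmetric]
  proof
    assume "\<exists>f\<in>disc_maps n. f \<zeta>1 = 0\<^sub>m n n \<and> f \<zeta>2 = W"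
    then obtain f where f: "f \<in> disc_maps n" "f \<zeta>1 = 0\<^sub>m n n" "f \<zeta>2 = W" by blast
    define \<phi> where "\<phi> = f \<circ> Moebius_function 0 (- \<zeta>1)"
    have hol: "Moebius_function 0 (- \<zeta>1) holomorphic_on ball 0 1"
      using \<zeta> by (intro Moebius_function_holomorphic) auto
    have ball: "Moebius_function 0 (- \<zeta>1) ` ball 0 1 \<subseteq> ball 0 1"
      using \<zeta> Moebius_function_norm_lt_1[of "- \<zeta>1"] by auto
    have "\<phi> \<in> disc_maps n"
      unfolding disc_maps_def
    proof (intro CollectI conjI ballI allI impI)
      show "\<phi> z \<in> spectral_unit_ball n" if "z \<in> ball 0 1" for z
        using f(1) subsetD[OF ball imageI[OF that]] by (simp add: disc_maps_def \<phi>_def)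
      fix i j assume "i < n" "j < n"
      then have "(\<lambda>z. f z $$ (i, j)) holomorphic_on ball 0 1"
        using f(1) by (auto simp: disc_maps_def)
      from holomorphic_on_compose_gen[OF hol this ball]
      show "(\<lambda>z. \<phi> z $$ (i, j)) holomorphic_on ball 0 1"
        by (simp add: \<phi>_def comp_def)
    qed
    moreover have "\<phi> 0 = 0\<^sub>m n n" "\<phi> m = W"
      using f inv by (simp_all add: \<phi>_def Moebius_function_of_zero)
    ultimately show "spectral_radius W \<le> cmod m"
      using spectral_radius_Schwarz[OF n, of \<phi> m] m1 by simp
  next
    assume le: "spectral_radius W \<le> cmod m"
    define M where "M = Moebius_function 0 \<zeta>1"
    have hol: "M holomorphic_on ball 0 1"
      unfolding M_def using \<zeta> by (intro Moebius_function_holomorphic) auto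
    have ball: "cmod (M z) < 1" if "z \<in> ball 0 1" for z
      unfolding M_def using \<zeta> that by (intro Moebius_function_norm_lt_1) auto
    \<comment> \<open>The scalar factor is 0 at \<open>\<zeta>1\<close> and 1 at
      \<open>\<zeta>2\<close>, since \<open>M\<close> takes the value \<open>m\<close>
      there.\<close>
    define f where "f z = (M z / m) \<cdot>\<^sub>m W" for z
    have "f \<in> disc_maps n"
      unfolding disc_maps_def
    proof (intro CollectI conjI ballI allI impI)
      fix z :: complex assume z: "z \<in> ball 0 1"
      have "spectral_radius (f z) \<le> cmod (M z / m) * spectral_radius W"
        unfolding f_def using Wc n by (rule spectral_radius_smult_le)
      also have "\<dots> \<le> cmod (M z / m) * cmod m"
        using le by (intro mult_left_mono) auto
      also have "\<dots> < 1"
        using ball[OF z] m0 by (simp add: norm_divide)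
      finally show "f z \<in> spectral_unit_ball n"
        using Wc by (simp add: spectral_unit_ball_def f_def)
    next
      fix i j assume "i < n" "j < n"
      then have "(\<lambda>z. f z $$ (i, j)) = (\<lambda>z. M z / m * W $$ (i, j))"
        using Wc by (simp add: f_def)
      then show "(\<lambda>z. f z $$ (i, j)) holomorphic_on ball 0 1"
        using hol m0 by (auto intro!: holomorphic_intros)
    qed
    moreover have "f \<zeta>1 = 0\<^sub>m n n"
      unfolding f_def M_def Moebius_function_eq_zero using Wc by auto
    moreover have "f \<zeta>2 = W"
      unfolding f_def M_def m_def[symmetric] using Wc m0 by auto
    ultimately show "\<exists>f\<in>disc_maps n. f \<zeta>1 = 0\<^sub>m n n \<and> f \<zeta>2 = W" by blast
  qed
qed

section \<open>The Lempert function at the zero matrix\<close>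

lemma poincare_dist_0: "poincare_dist 0 \<zeta> = artanh (cmod \<zeta>)"
  by (simp add: poincare_dist_def)

lemma artanh_mono:
  fixes x y :: real
  assumes "-1 < x" "x \<le> y" "y < 1"
  shows "artanh x \<le> artanh y"
proof -
  have "(1 + x) / (1 - x) \<le> (1 + y) / (1 - y)"
    using assms by (intro frac_le) auto
  then show ?thesis using assms by (simp add: artanh_def)
qed

theorem lempert_zero:
  assumes n: "n > 0" and W: "W \<in> spectral_unit_ball n"
  shows "lempert n (0\<^sub>m n n) W = artanh (spectral_radius W)"
proof -
  have Wc: "W \<in> carrier_mat n n" and r1: "spectral_radius W < 1"
    using W by (auto simp: spectral_unit_ball_def)
  have r0: "0 \<le> spectral_radius W" using Wc n by (rule spectral_radius_nonneg)
  define S where "S = {poincare_dist 0 \<zeta> | \<zeta>. \<zeta> \<in> ball 0 1 \<and>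
     (\<exists>\<phi>\<in>disc_maps n. \<phi> 0 = 0\<^sub>m n n \<and> \<phi> \<zeta> = W)}"
  have lower: "artanh (spectral_radius W) \<le> x" if "x \<in> S" for x
  proof -
    from that obtain \<zeta> \<phi> where *: "x = artanh (cmod \<zeta>)" "\<zeta> \<in> ball 0 1" "\<phi> \<in> disc_maps n"
      "\<phi> 0 = 0\<^sub>m n n" "\<phi> \<zeta> = W" unfolding S_def poincare_dist_0 by blast
    have "spectral_radius W \<le> cmod \<zeta>"
      using spectral_radius_Schwarz[OF n *(3,4,2)] *(5) by simp
    then show ?thesis using * r0 by (auto intro!: artanh_mono)
  qed
  \<comment> \<open>The radius is approached strictly from above: for a nonzero nilpotent
    \<open>W\<close> the infimum is 0 but is not attained, as \<open>\<zeta> = 0\<close> would force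
    \<open>W\<close> to be zero.\<close>
  have mem: "artanh x \<in> S" if "spectral_radius W < x" "x < 1" for x
  proof -
    have "\<exists>\<phi>\<in>disc_maps n. \<phi> 0 = 0\<^sub>m n n \<and> \<phi> (of_real x) = W"
      using disc_maps_Schwarz_Pick[OF n W, of 0 "of_real x"] r0 that by auto
    moreover have "artanh x = poincare_dist 0 (of_real x)"
      using r0 that by (simp add: poincare_dist_0)
    ultimately show ?thesis using r0 that unfolding S_def by force
  qed
  have "Inf S = artanh (spectral_radius W)"
  proof (rule antisym)
    have "eventually (\<lambda>x. Inf S \<le> artanh x) (at_right (spectral_radius W))"
      using eventually_at_right_real[OF r1]
      by eventually_elim (auto intro!: cInf_lower mem bdd_belowI[of S, OF lower])
    moreover have "(artanh \<longlongrightarrow> artanh (spectral_radius W)) (at_right (spectral_radius W))"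
      using r0 r1 by (intro tendsto_artanh tendsto_ident_at) auto
    ultimately show "Inf S \<le> artanh (spectral_radius W)"
      by (intro tendsto_lowerbound[of artanh]) auto
    \<comment> \<open>This point shows that \<open>S\<close> is nonempty, without which the real
      infimum would carry no information.\<close>
    obtain x where "spectral_radius W < x" "x < 1" using dense[OF r1] by blast
    then show "artanh (spectral_radius W) \<le> Inf S"
      using mem lower by (intro cInf_greatest) auto
  qed
  then show ?thesis by (simp add: lempert_def S_def)
qed

section \<open>The rational function in terms of the reversed characteristic polynomial\<close>

lemma coeff_reflect_char_poly:
  assumes "W \<in> carrier_mat n n" "j \<le> n"
  shows "coeff (reflect_poly (char_poly W)) j = (-1) ^ j * char_coeff W j"
  using assms degree_monic_char_poly[OF assms(1)]
  by (simp add: coeff_reflect_poly char_coeff_def mult.assoc[symmetric] flip: power_add mult_2)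

lemma poly_as_sum:
  fixes p :: "'a :: comm_semiring_1 poly"
  assumes "degree p \<le> n"
  shows "poly p z = (\<Sum>j\<le>n. coeff p j * z ^ j)"
  using assms unfolding poly_altdef
  by (intro sum.mono_neutral_left) (auto simp: coeff_eq_0)

text \<open>The coefficient of \<open>z ^ j\<close> in \<open>q\<close> is the signed
  \<open>s j\<close>. Differentiation brings down \<open>j\<close> in the numerator, and
  \<open>n * q - z * q'\<close> multiplies the coefficient by \<open>n - j\<close>.\<close>

lemma rat_F_eq:
  assumes W: "W \<in> carrier_mat n n"
  defines "q \<equiv> reflect_poly (char_poly W)"
  shows "rat_F W = remove_sings (\<lambda>z. poly (pderiv q) z / (of_nat n * poly q z - z * poly (pderiv q) z))"
proof -
  have deg: "degree q \<le> n"
    using degree_reflect_poly_le[of "char_poly W"] degree_monic_char_poly[OF W] by (simp add: q_def)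
  have c: "coeff q j = (-1) ^ j * char_coeff W j" if "j \<le> n" for j
    unfolding q_def using W that by (rule coeff_reflect_char_poly)
  have dim: "dim_row W = n" using W by simp
  have num: "poly (pderiv q) z = (\<Sum>j=1..n. (-1) ^ j * of_nat j * char_coeff W j * z ^ (j - 1))" for z
  proof (cases n)
    case 0
    with deg have "pderiv q = 0" by (simp add: pderiv_eq_0_iff)
    then show ?thesis by (simp add: 0)
  next
    case (Suc m)
    have "poly (pderiv q) z = (\<Sum>j\<le>m. coeff (pderiv q) j * z ^ j)"
      using deg Suc by (intro poly_as_sum) (simp add: degree_pderiv)
    also have "\<dots> = (\<Sum>j=1..n. (-1) ^ j * of_nat j * char_coeff W j * z ^ (j - 1))"
      by (rule sum.reindex_bij_witness[of _ "\<lambda>j. j - 1" Suc]) (auto simp: Suc coeff_pderiv c)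
    finally show ?thesis .
  qed
  have den: "of_nat n * poly q z - z * poly (pderiv q) z =
      of_nat n + (\<Sum>j=1..n-1. (-1) ^ j * of_nat (n - j) * char_coeff W j * z ^ j)" for z
  proof (cases n)
    case 0
    with deg have "pderiv q = 0" by (simp add: pderiv_eq_0_iff)
    then show ?thesis by (simp add: 0)
  next
    case (Suc m)
    define f where "f j = (-1) ^ j * of_nat (n - j) * char_coeff W j * z ^ j" for j
    have "z * poly (pderiv q) z = (\<Sum>j=1..n. of_nat j * (coeff q j * z ^ j))"
      unfolding num sum_distrib_left
      by (intro sum.cong) (auto simp: c mult_ac power_eq_if)
    also have "\<dots> = (\<Sum>j\<le>n. of_nat j * (coeff q j * z ^ j))"
      by (intro sum.mono_neutral_left) (auto simp: not_le)
    finally have "of_nat n * poly q z - z * poly (pderiv q) z =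
        (\<Sum>j\<le>n. of_nat n * (coeff q j * z ^ j) - of_nat j * (coeff q j * z ^ j))"
      unfolding poly_as_sum[OF deg] sum_distrib_left sum_subtractf by simp
    also have "\<dots> = (\<Sum>j\<le>n. f j)"
      by (intro sum.cong) (auto simp: f_def c of_nat_diff algebra_simps)
    \<comment> \<open>The end terms are special: \<open>j = 0\<close> gives \<open>n\<close> because
      the leading coefficient is 1, and \<open>j = n\<close> gives 0.\<close>
    also have "{..n} = insert 0 (insert n {1..n-1})"
      using Suc by auto
    also have "(\<Sum>j\<in>insert 0 (insert n {1..n-1}). f j) = of_nat n + (\<Sum>j=1..n-1. f j)"
      using Suc char_coeff_0[OF W] by (auto simp: f_def)
    finally show ?thesis by (simp add: f_def)
  qed
  show ?thesis
    unfolding rat_F_def Let_def dim num[symmetric] den[symmetric] ..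
qed

lemma analytic_on_poly_id: "poly p analytic_on A" for p :: "complex poly"
proof -
  have "poly p analytic_on UNIV"
    using poly_holomorphic_on[OF holomorphic_on_ident] by (simp add: analytic_on_open)
  then show ?thesis by (rule analytic_on_subset) simp
qed

lemma reflect_char_poly_prod:
  fixes W :: "complex mat"
  assumes "char_poly W = (\<Prod>i<n. [:- a i, 1:])"
  shows "reflect_poly (char_poly W) = (\<Prod>i<n. [:1, - a i:])"
proof -
  have "reflect_poly [:- b, 1:] = [:1, - b:]" for b :: complex
    \<comment> \<open>A zero eigenvalue reflects to the constant 1, which is still
      \<open>[:1, - b:]\<close>; the degree drops.\<close>
    by (cases "b = 0") (simp_all add: reflect_poly_pCons reflect_poly_pCons' monom_0)
  then show ?thesis using assms by (simp add: reflect_poly_prod)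
qed

section \<open>Values of \<open>rat_F\<close> and the infimum \<open>F_radius\<close>\<close>

text \<open>The logarithmic derivative of \<open>q\<close> gives
  \<open>z * q' = q * (n - U)\<close>, where \<open>U\<close> sums the
  \<open>1 / (1 - a i * z)\<close>. Hence the denominator is \<open>q * U\<close>, and
  \<open>z * F = (n - U) / U\<close>.\<close>

lemma rat_F_small_disc:
  assumes W: "W \<in> carrier_mat n n" and n: "n > 0" and z: "cmod z * spectral_radius W < 1"
  shows "rat_F W analytic_on {z}" and "cmod (z * rat_F W z) < 1"
proof -
  define q where "q = reflect_poly (char_poly W)"
  obtain a where a: "char_poly W = (\<Prod>i<n. [:- a i, 1:])"
    by (rule eigenvalue_enumeration[OF W]) blast
  have q: "q = (\<Prod>i<n. [:1, - a i:])"
    unfolding q_def using a by (rule reflect_char_poly_prod)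
  have az: "cmod (a i * z) < 1" if "i < n" for i
  proof -
    have "cmod (a i) \<le> spectral_radius W"
      using spectral_radius_mem_max(2)[OF W n, of "cmod (a i)"] that spectrum_prod[OF W a] by force
    then have "cmod (a i * z) \<le> cmod z * spectral_radius W"
      by (simp add: norm_mult mult.commute mult_left_mono)
    with z show ?thesis by simp
  qed
  then have ne: "1 - a i * z \<noteq> 0" if "i < n" for i
    using that by fastforce
  define u where "u i = 1 / (1 - a i * z)" for i
  define U where "U = (\<Sum>i<n. u i)"
  have q0: "poly q z \<noteq> 0"
    unfolding q poly_prod using ne by (auto simp: mult.commute)
  have "poly (pderiv q) z = (\<Sum>i<n. - a i * (\<Prod>j\<in>{..<n} - {i}. poly [:1, - a j:] z))"
    unfolding q pderiv_prod poly_sum poly_mult poly_prod by (simp add: pderiv_pCons mult.commute)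
  also have "\<dots> = (\<Sum>i<n. poly q z * (- a i * u i))"
  proof (rule sum.cong)
    fix i assume i: "i \<in> {..<n}"
    then have "poly q z = (1 - a i * z) * (\<Prod>j\<in>{..<n} - {i}. poly [:1, - a j:] z)"
      unfolding q poly_prod by (simp add: prod.remove[of "{..<n}" i] mult.commute)
    then show "- a i * (\<Prod>j\<in>{..<n} - {i}. poly [:1, - a j:] z) = poly q z * (- a i * u i)"
      using ne[of i] i by (simp add: u_def)
  qed auto
  finally have dq: "poly (pderiv q) z = poly q z * (\<Sum>i<n. - a i * u i)"
    by (simp only: sum_distrib_left)
  have "z * (\<Sum>i<n. - a i * u i) = (\<Sum>i<n. 1 - u i)"
    unfolding sum_distrib_left using ne by (intro sum.cong) (auto simp: u_def field_simps)
  then have zdq: "z * poly (pderiv q) z = poly q z * (of_nat n - U)"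
    unfolding dq by (simp add: U_def sum_subtractf mult.left_commute)
  define den where "den w = of_nat n * poly q w - w * poly (pderiv q) w" for w
  have den: "den z = poly q z * U"
    by (simp add: den_def zdq algebra_simps)
  have "real n / 2 = (\<Sum>i<n. 1 / 2)" by simp
  also have "\<dots> < (\<Sum>i<n. Re (u i))"
    unfolding u_def using n az by (intro sum_strict_mono Re_inverse_one_minus) auto
  finally have ReU: "real n / 2 < Re U" by (simp add: U_def)
  with n have U0: "U \<noteq> 0" by auto
  have F: "rat_F W = remove_sings (\<lambda>w. poly (pderiv q) w / den w)"
    unfolding den_def q_def using W by (rule rat_F_eq)
  have an: "(\<lambda>w. poly (pderiv q) w / den w) analytic_on {z}"
    using den q0 U0 unfolding den_def by (intro analytic_intros analytic_on_poly_id) auto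
  then show "rat_F W analytic_on {z}"
    unfolding F by (rule remove_sings_analytic_on)
  have "z * rat_F W z = (of_nat n - U) / U"
    using an q0 unfolding F by (simp add: den zdq)
  \<comment> \<open>Geometrically, \<open>U\<close> lies closer to \<open>n\<close> than to 0, which
    is exactly \<open>Re U > n / 2\<close>.\<close>
  moreover have "cmod (of_nat n - U) < cmod U"
  proof -
    have "(cmod (of_nat n - U))\<^sup>2 = (cmod U)\<^sup>2 + real n * (real n - 2 * Re U)"
      unfolding cmod_power2 by (simp add: power2_eq_square algebra_simps)
    also have "\<dots> < (cmod U)\<^sup>2"
      using ReU n by (simp add: mult_pos_neg)
    finally show ?thesis by (rule power_less_imp_less_base) simp
  qed
  ultimately show "cmod (z * rat_F W z) < 1"
    using U0 by (simp add: norm_divide)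
qed

text \<open>A root of \<open>q\<close> of order \<open>k + 1\<close> leaves a common factor of order
  \<open>k\<close> in numerator and denominator. After cancellation, \<open>1 + w * F w\<close>
  still has a simple factor \<open>w - b\<close> over a nonzero denominator, so it tends to
  0.\<close>

lemma rat_F_at_reciprocal_eigenvalue:
  assumes W: "W \<in> carrier_mat n n" and n: "n > 0" and \<mu>: "\<mu> \<in> spectrum W" "\<mu> \<noteq> 0"
    and an: "rat_F W analytic_on {1 / \<mu>}"
  shows "1 / \<mu> * rat_F W (1 / \<mu>) = -1"
proof -
  define q where "q = reflect_poly (char_poly W)"
  define b where "b = 1 / \<mu>"
  have q00: "poly q 0 = 1"
    unfolding q_def using degree_monic_char_poly[OF W] by (simp add: poly_0_coeff_0 coeff_reflect_poly)
  then have "q \<noteq> 0" by auto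
  have "poly q b = 0"
    using \<mu> W by (simp add: q_def b_def poly_reflect_poly_nz spectrum_root_char_poly)
  with \<open>q \<noteq> 0\<close> obtain k where k: "order b q = Suc k"
    by (metis order_root not0_implies_Suc)
  obtain h where h: "q = [:- b, 1:] ^ Suc k * h" "\<not> [:- b, 1:] dvd h"
    using order_decomp[OF \<open>q \<noteq> 0\<close>, of b] k by auto
  then have hb: "poly h b \<noteq> 0" by (simp add: poly_eq_0_iff_dvd)
  have q: "poly q w = (w - b) ^ k * ((w - b) * poly h w)" for w
    unfolding h(1) by (simp add: algebra_simps)
  have dq: "poly (pderiv q) w = (w - b) ^ k * (of_nat (Suc k) * poly h w + (w - b) * poly (pderiv h) w)" for w
    unfolding h(1) pderiv_mult pderiv_power_Suc
    by (simp add: pderiv_pCons algebra_simps)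
  \<comment> \<open>The cofactor of \<open>(w - b) ^ k\<close> in the denominator; at
    \<open>b\<close> it equals \<open>- (k + 1) * b * h b\<close>.\<close>
  define E where "E w = of_nat n * ((w - b) * poly h w)
    - w * (of_nat (Suc k) * poly h w + (w - b) * poly (pderiv h) w)" for w
  have Eb: "E b \<noteq> 0"
    using hb \<mu>(2) by (simp add: E_def b_def del: of_nat_Suc)
  have den: "of_nat n * poly q w - w * poly (pderiv q) w = (w - b) ^ k * E w" for w
    unfolding q dq E_def by (simp add: algebra_simps)
  have F: "rat_F W = remove_sings (\<lambda>w. poly (pderiv q) w / ((w - b) ^ k * E w))"
    unfolding den[symmetric] q_def using W by (rule rat_F_eq)
  have E_cont: "isCont E b"
    unfolding E_def by (intro continuous_intros)
  have "(\<lambda>w. poly (pderiv q) w / ((w - b) ^ k * E w)) meromorphic_on {b}"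
    unfolding E_def by (intro meromorphic_intros analytic_on_imp_meromorphic_on analytic_intros
        analytic_on_poly_id)
  then have iso: "isolated_singularity_at (\<lambda>w. poly (pderiv q) w / ((w - b) ^ k * E w)) b"
    by (rule meromorphic_on_isolated_singularity)
  have "eventually (\<lambda>w. E w \<noteq> 0) (at b)"
    using E_cont Eb by (metis isContD tendsto_imp_eventually_ne)
  with eventually_remove_sings_eq_at[OF iso, folded F] eventually_neq_at_within[of b b UNIV]
  have "eventually (\<lambda>w. of_nat n * ((w - b) * poly h w) / E w = 1 + w * rat_F W w) (at b)"
  proof eventually_elim
    case (elim w)
    then have "w * rat_F W w = w * (of_nat (Suc k) * poly h w + (w - b) * poly (pderiv h) w) / E w"
      by (simp add: dq del: of_nat_Suc)
    also have "\<dots> = (of_nat n * ((w - b) * poly h w) - E w) / E w"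
      by (simp add: E_def)
    also have "\<dots> = of_nat n * ((w - b) * poly h w) / E w - 1"
      using elim(3) by (simp add: diff_divide_distrib)
    finally show ?case by simp
  qed
  moreover have "((\<lambda>w. of_nat n * ((w - b) * poly h w) / E w) \<longlongrightarrow> of_nat n * ((b - b) * poly h b) / E b) (at b)"
    using E_cont Eb by (intro tendsto_intros) (auto simp: isCont_def)
  ultimately have "((\<lambda>w. 1 + w * rat_F W w) \<longlongrightarrow> 0) (at b)"
    using Lim_transform_eventually by fastforce
  \<comment> \<open>Continuity of \<open>rat_F W\<close> at \<open>b\<close> turns the limit over
    the punctured neighbourhood into a value.\<close>
  moreover have "((\<lambda>w. 1 + w * rat_F W w) \<longlongrightarrow> 1 + b * rat_F W b) (at b)"
    using analytic_at_imp_isCont[OF an] unfolding b_def[symmetric] isCont_def by (intro tendsto_intros)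
  ultimately have "1 + b * rat_F W b = 0"
    using LIM_unique by blast
  then show ?thesis by (simp add: b_def add_eq_0_iff)
qed

text \<open>The admissible \<open>t\<close> form exactly the open half-line above the spectral
  radius.\<close>

theorem F_radius_eq_spectral_radius:
  assumes W: "W \<in> carrier_mat n n" and n: "n > 0"
  shows "F_radius W = spectral_radius W"
proof -
  have r0: "0 \<le> spectral_radius W" using W n by (rule spectral_radius_nonneg)
  have compact_image: "compact ((\<lambda>z. cmod (rat_F W z)) ` sphere 0 (1 / t))"
    if "rat_F W analytic_on cball 0 (1 / t)" for t
  proof -
    have "continuous_on (sphere 0 (1 / t)) (rat_F W)"
      using analytic_on_subset[OF that sphere_cball]
      by (intro holomorphic_on_imp_continuous_on analytic_imp_holomorphic)
    then show ?thesis by (intro compact_continuous_image continuous_intros) auto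
  qed
  have "{t. 0 < t \<and> (\<forall>z\<in>cball 0 (1 / t). \<not> is_pole (rat_F W) z) \<and>
     1 / t * (SUP z\<in>sphere 0 (1 / t). cmod (rat_F W z)) < 1} = {spectral_radius W<..}"
  proof (intro equalityI subsetI)
    fix t assume "t \<in> {spectral_radius W<..}"
    then have t: "spectral_radius W < t" "0 < t" using r0 by auto
    have z: "cmod z * spectral_radius W < 1" if "z \<in> cball 0 (1 / t)" for z
    proof -
      have "cmod z * spectral_radius W \<le> 1 / t * spectral_radius W"
        using that r0 by (intro mult_right_mono) auto
      also have "\<dots> < 1" using t by simp
      finally show ?thesis .
    qed
    have an: "rat_F W analytic_on cball 0 (1 / t)"
      using rat_F_small_disc(1)[OF W n z] analytic_on_analytic_at by blast
    have "compact ((\<lambda>z. cmod (rat_F W z)) ` sphere 0 (1 / t))"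
      using an by (rule compact_image)
    moreover have "sphere (0::complex) (1 / t) \<noteq> {}"
      using t by simp
    \<comment> \<open>The supremum is attained at some \<open>w\<close>, so the strict pointwise
      estimate survives passage to it.\<close>
    ultimately have "(SUP z\<in>sphere 0 (1 / t). cmod (rat_F W z)) \<in> (\<lambda>z. cmod (rat_F W z)) ` sphere 0 (1 / t)"
      by (intro closed_contains_Sup compact_imp_closed bounded_imp_bdd_above compact_imp_bounded) auto
    then obtain w where w: "cmod w = 1 / t" "(SUP z\<in>sphere 0 (1 / t). cmod (rat_F W z)) = cmod (rat_F W w)"
      by auto
    have "cmod (w * rat_F W w) < 1"
      using w t by (intro rat_F_small_disc(2)[OF W n z]) auto
    moreover have "\<not> is_pole (rat_F W) z" if "z \<in> cball 0 (1 / t)" for z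
      using rat_F_small_disc(1)[OF W n z[OF that]] analytic_at_imp_no_pole by blast
    ultimately show "t \<in> {t. 0 < t \<and> (\<forall>z\<in>cball 0 (1 / t). \<not> is_pole (rat_F W) z) \<and>
       1 / t * (SUP z\<in>sphere 0 (1 / t). cmod (rat_F W z)) < 1}"
      using t w by (simp add: norm_mult)
  next
    fix t assume "t \<in> {t. 0 < t \<and> (\<forall>z\<in>cball 0 (1 / t). \<not> is_pole (rat_F W) z) \<and>
       1 / t * (SUP z\<in>sphere 0 (1 / t). cmod (rat_F W z)) < 1}"
    then have t: "0 < t" and pole: "\<And>z. z \<in> cball 0 (1 / t) \<Longrightarrow> \<not> is_pole (rat_F W) z"
      and sup: "1 / t * (SUP z\<in>sphere 0 (1 / t). cmod (rat_F W z)) < 1" by auto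
    show "t \<in> {spectral_radius W<..}"
    proof (rule ccontr)
      assume "t \<notin> {spectral_radius W<..}"
      then have tr: "t \<le> spectral_radius W" by simp
      obtain \<mu> where \<mu>: "\<mu> \<in> spectrum W" "spectral_radius W = cmod \<mu>"
        using spectral_radius_mem_max(1)[OF W n] by auto
      have \<mu>0: "\<mu> \<noteq> 0" using t tr \<mu> by auto
      have \<mu>t: "1 / \<mu> \<in> cball 0 (1 / t)"
        using t tr \<mu> by (simp add: norm_divide frac_le)
      \<comment> \<open>After removal of singularities, a point that is no pole is a point of
        analyticity.\<close>
      have "rat_F W nicely_meromorphic_on UNIV"
        unfolding rat_F_eq[OF W] by (intro remove_sings_nicely_meromorphic meromorphic_intros
            analytic_on_imp_meromorphic_on analytic_intros analytic_on_poly_id)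
      then have an: "rat_F W analytic_on {z}" if "z \<in> cball 0 (1 / t)" for z
        using pole[OF that] by (intro nicely_meromorphic_on_imp_analytic_at) auto
      then have an': "rat_F W analytic_on cball 0 (1 / t)"
        using analytic_on_analytic_at by blast
      \<comment> \<open>On the circle \<open>cmod z = 1 / t\<close>, so \<open>B\<close> bounds
        \<open>z * rat_F W z\<close> there. The point \<open>1 / \<mu>\<close> of the disc, where
        the modulus is 1, contradicts \<open>B < 1\<close>.\<close>
      define B where "B = 1 / t * (SUP z\<in>sphere 0 (1 / t). cmod (rat_F W z))"
      have hol: "(\<lambda>z. z * rat_F W z) holomorphic_on cball 0 (1 / t)"
        using analytic_imp_holomorphic[OF an'] by (intro holomorphic_intros)
      have "cmod (1 / \<mu> * rat_F W (1 / \<mu>)) \<le> B"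
      proof (rule maximum_modulus_frontier[where f = "\<lambda>z. z * rat_F W z" and S = "cball 0 (1 / t)"])
        show "(\<lambda>z. z * rat_F W z) holomorphic_on interior (cball 0 (1 / t))"
          using hol interior_subset by (rule holomorphic_on_subset)
        show "continuous_on (closure (cball 0 (1 / t))) (\<lambda>z. z * rat_F W z)"
          using hol by (simp add: holomorphic_on_imp_continuous_on)
        fix z :: complex assume "z \<in> frontier (cball 0 (1 / t))"
        then have z: "z \<in> sphere 0 (1 / t)" using t by simp
        then have "cmod (rat_F W z) \<le> (SUP z\<in>sphere 0 (1 / t). cmod (rat_F W z))"
          by (intro cSUP_upper bounded_imp_bdd_above compact_imp_bounded compact_image an')
        then show "cmod (z * rat_F W z) \<le> B"
          using z t by (simp add: B_def norm_mult divide_right_mono)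
      qed (use \<mu>t in auto)
      moreover have "1 / \<mu> * rat_F W (1 / \<mu>) = -1"
        using W n \<mu>(1) \<mu>0 an[OF \<mu>t] by (rule rat_F_at_reciprocal_eigenvalue)
      ultimately show False using sup by (simp add: B_def)
    qed
  qed
  then show ?thesis unfolding F_radius_def by simp
qed

theorem theorem1p8:
  fixes n :: nat and W :: "complex mat"
  assumes "n \<ge> 2" and "W \<in> spectral_unit_ball n"
  shows "(lempert n (0\<^sub>m n n) W = artanh (F_radius W) \<and>
          artanh (F_radius W) = artanh (spectral_radius W)) \<and>
         (\<forall>\<zeta>\<^sub>1\<in>ball 0 1. \<forall>\<zeta>\<^sub>2\<in>ball 0 1. \<zeta>\<^sub>1 \<noteq> \<zeta>\<^sub>2 \<longrightarrow>
            ((\<exists>f\<in>disc_maps n. f \<zeta>\<^sub>1 = 0\<^sub>m n n \<and> f \<zeta>\<^sub>2 = W) \<longleftrightarrow>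
             (spectral_radius W = F_radius W \<and>
              F_radius W \<le> cmod ((\<zeta>\<^sub>2 - \<zeta>\<^sub>1) / (1 - cnj \<zeta>\<^sub>1 * \<zeta>\<^sub>2)))))"
proof -
  have n: "n > 0" and Wc: "W \<in> carrier_mat n n"
    using assms by (auto simp: spectral_unit_ball_def)
  have "F_radius W = spectral_radius W"
    using Wc n by (rule F_radius_eq_spectral_radius)
  moreover have "lempert n (0\<^sub>m n n) W = artanh (spectral_radius W)"
    using n assms(2) by (rule lempert_zero)
  ultimately show ?thesis
    using disc_maps_Schwarz_Pick[OF n assms(2)] by simp
qed

end
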